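(* For any integer $r\ge 3$, we have $G^{\mathrm{Pink}}_{r,1,\infty}=\tilde B_{r,1,\infty}$.
   Context: $T_\infty$ is the infinite binary rooted tree whose nodes are finite words in $\{a,b\}$ (root = empty word, $w$ joined to $wa,wb$), with automorphism group $\mathrm{Aut}(T_\infty)$ (profinite topology). For $\sigma\in\mathrm{Aut}(T_\infty)$ and a word $x$, $\mathrm{Par}(\sigma,x)\in\mathbb{Z}/2\mathbb{Z}$ is $0$ if $\sigma(xa)=\sigma(x)a$ and $1$ if $\sigma(xa)=\sigma(x)b$. Define $P^a_{r,1}(\sigma,x)=\mathrm{Par}(\sigma,xb)+\sum_{w\in\{a,b\}^{r-1}}\mathrm{Par}(\sigma,xaw)$ and $P^b_{r,1}(\sigma,x)=\mathrm{Par}(\sigma,xa)+\sum_{w\in\{a,b\}^{r-1}}\mathrm{Par}(\sigma,xbw)$ in $\mathbb{Z}/2\mathbb{Z}$; $M_{r,1,\infty}$ is the set of $\sigma$ for which all these values over all nodes coincide (common value $P_{r,1}(\sigma)$), and $B_{r,1,\infty}=\{\sigma\in M_{r,1,\infty}:P_{r,1}(\sigma)=0\}$. Define $R_{r,1}(\sigma,x)=\mathrm{Par}(\sigma,xa)\mathrm{Par}(\sigma,xb)+\sum_{w\in\{a,b\}^{r-2}}(\mathrm{Par}(\sigma,xabw)+\mathrm{Par}(\sigma,xbbw))\in\mathbb{Z}/2\mathbb{Z}$; $\tilde M_{r,1,\infty}$ is the set of $\sigma\in B_{r,1,\infty}$ with $R_{r,1}(\sigma,x)$ independent of $x$ (common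 value $R_{r,1}(\sigma)$), and $\tilde B_{r,1,\infty}=\{\sigma\in\tilde M_{r,1,\infty}:R_{r,1}(\sigma)=0\}$. Pink's group: $G^{\mathrm{Pink}}_{r,1,\infty}$ is the closure of the subgroup generated by $\alpha_1,\dots,\alpha_r\in\mathrm{Aut}(T_\infty)$, where $\mathrm{Par}(\alpha_1,x)=1$ iff $x$ is the root, and for $2\le i\le r$, $\mathrm{Par}(\alpha_i,w)=1$ iff $w=a^{i-2}(ba^{r-2})^na$ for some $n\ge0$ (here $u^j$ denotes $j$ consecutive copies of the word $u$). Equivalently $\alpha_1=\tau$, $\alpha_2=(\alpha_1,\alpha_r)$, $\alpha_i=(\alpha_{i-1},1)$ for $i\ge3$, where $(\alpha,\beta)$ fixes $a,b$ and acts as $\alpha$ above $a$ and $\beta$ above $b$. *)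

theory Defs
  imports
    "HOL-Analysis.Function_Topology"
    "HOL-Algebra.Generated_Groups"
    "HOL-Library.Z2"
begin

(* The head of a word is the letter nearest to the root, so the children of w are w @ [A], w @ [B]. *)

datatype letter = A | B

type_synonym word = "letter list"

definition tree_adj :: "word \<Rightarrow> word \<Rightarrow> bool" where
  "tree_adj u v \<longleftrightarrow> (\<exists>c. v = u @ [c]) \<or> (\<exists>c. u = v @ [c])"

definition tree_aut :: "(word \<Rightarrow> word) set" where
  "tree_aut = {\<sigma>. bij \<sigma> \<and> \<sigma> [] = [] \<and> (\<forall>u v. tree_adj (\<sigma> u) (\<sigma> v) \<longleftrightarrow> tree_adj u v)}"

definition tree_aut_group :: "(word \<Rightarrow> word) monoid" where
  "tree_aut_group = \<lparr>carrier = tree_aut, mult = (\<circ>), one = id\<rparr>"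

(* Aut(T) is the inverse limit of the finite discrete groups Aut(T_n): the topology is pulled back
   along the embedding into the product over n given by restriction to words of length at most n. *)

definition profinite_topology :: "(word \<Rightarrow> word) topology" where
  "profinite_topology =
     pullback_topology tree_aut (\<lambda>\<sigma> n. restrict \<sigma> {w. length w \<le> n})
       (product_topology (\<lambda>n::nat. discrete_topology (UNIV :: (word \<Rightarrow> word) set)) UNIV)"

(* The type bit of HOL-Library.Z2 is the field Z/2Z. *)

definition par :: "(word \<Rightarrow> word) \<Rightarrow> word \<Rightarrow> bit" where
  "par \<sigma> x = (if \<sigma> (x @ [A]) = \<sigma> x @ [A] then 0 else 1)"

definition Pa :: "nat \<Rightarrow> (word \<Rightarrow> word) \<Rightarrow> word \<Rightarrow> bit" where
  "Pa r \<sigma> x = par \<sigma> (x @ [B]) + (\<Sum>w | length w = r - 1. par \<sigma> (x @ [A] @ w))"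

definition Pb :: "nat \<Rightarrow> (word \<Rightarrow> word) \<Rightarrow> word \<Rightarrow> bit" where
  "Pb r \<sigma> x = par \<sigma> (x @ [A]) + (\<Sum>w | length w = r - 1. par \<sigma> (x @ [B] @ w))"

definition M_group :: "nat \<Rightarrow> (word \<Rightarrow> word) set" where
  "M_group r = {\<sigma> \<in> tree_aut. \<exists>c. \<forall>x. Pa r \<sigma> x = c \<and> Pb r \<sigma> x = c}"

definition P_val :: "nat \<Rightarrow> (word \<Rightarrow> word) \<Rightarrow> bit" where
  "P_val r \<sigma> = (THE c. \<forall>x. Pa r \<sigma> x = c \<and> Pb r \<sigma> x = c)"

definition B_group :: "nat \<Rightarrow> (word \<Rightarrow> word) set" where
  "B_group r = {\<sigma> \<in> M_group r. P_val r \<sigma> = 0}"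

definition R_at :: "nat \<Rightarrow> (word \<Rightarrow> word) \<Rightarrow> word \<Rightarrow> bit" where
  "R_at r \<sigma> x = par \<sigma> (x @ [A]) * par \<sigma> (x @ [B])
     + (\<Sum>w | length w = r - 2. par \<sigma> (x @ [A, B] @ w) + par \<sigma> (x @ [B, B] @ w))"

definition M_tilde :: "nat \<Rightarrow> (word \<Rightarrow> word) set" where
  "M_tilde r = {\<sigma> \<in> B_group r. \<exists>c. \<forall>x. R_at r \<sigma> x = c}"

definition R_val :: "nat \<Rightarrow> (word \<Rightarrow> word) \<Rightarrow> bit" where
  "R_val r \<sigma> = (THE c. \<forall>x. R_at r \<sigma> x = c)"

definition B_tilde :: "nat \<Rightarrow> (word \<Rightarrow> word) set" where
  "B_tilde r = {\<sigma> \<in> M_tilde r. R_val r \<sigma> = 0}"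

fun flip :: "letter \<Rightarrow> letter" where
  "flip A = B"
| "flip B = A"

(* The unique tree automorphism whose parity at x is 1 exactly when p x holds;
   see portrait_aut_in, par_portrait_aut and tree_aut_eqI below. *)

fun portrait_aut :: "(word \<Rightarrow> bool) \<Rightarrow> word \<Rightarrow> word" where
  "portrait_aut p [] = []"
| "portrait_aut p (c # w) = (if p [] then flip c else c) # portrait_aut (\<lambda>x. p (c # x)) w"

definition pink_gen :: "nat \<Rightarrow> nat \<Rightarrow> word \<Rightarrow> word" where
  "pink_gen r i = portrait_aut (\<lambda>x.
     if i = 1 then x = []
     else \<exists>n. x = replicate (i - 2) A @ concat (replicate n (B # replicate (r - 2) A)) @ [A])"

definition G_Pink :: "nat \<Rightarrow> (word \<Rightarrow> word) set" where
  "G_Pink r = profinite_topology closure_of generate tree_aut_group (pink_gen r ` {1..r})"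


lemma group_tree_aut_group: "group tree_aut_group"
proof (rule groupI)
  fix \<sigma> assume "\<sigma> \<in> carrier tree_aut_group"
  then have \<sigma>: "bij \<sigma>" "\<sigma> [] = []" "\<And>u v. tree_adj (\<sigma> u) (\<sigma> v) \<longleftrightarrow> tree_adj u v"
    by (auto simp: tree_aut_group_def tree_aut_def)
  define \<rho> where "\<rho> = inv_into UNIV \<sigma>"
  have \<sigma>\<rho>: "\<sigma> (\<rho> u) = u" and \<rho>\<sigma>: "\<rho> (\<sigma> u) = u" for u
    using \<sigma>(1) by (simp_all add: \<rho>_def bij_is_inj bij_is_surj surj_f_inv_f)
  have "bij \<rho>"
    using \<sigma>(1) by (simp add: \<rho>_def bij_imp_bij_inv)
  moreover have "\<rho> [] = []"
    using \<rho>\<sigma>[of "[]"] \<sigma>(2) by simp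
  moreover have "tree_adj (\<rho> u) (\<rho> v) \<longleftrightarrow> tree_adj u v" for u v
    using \<sigma>(3)[of "\<rho> u" "\<rho> v"] by (simp add: \<sigma>\<rho>)
  ultimately have "\<rho> \<in> tree_aut"
    by (simp add: tree_aut_def)
  moreover have "\<rho> \<circ> \<sigma> = id"
    by (auto simp: \<rho>\<sigma>)
  ultimately show "\<exists>\<rho> \<in> carrier tree_aut_group. \<rho> \<otimes>\<^bsub>tree_aut_group\<^esub> \<sigma> = \<one>\<^bsub>tree_aut_group\<^esub>"
    by (auto simp: tree_aut_group_def)
qed (auto simp: tree_aut_group_def tree_aut_def bij_comp comp_assoc)

lemma tree_aut_snoc:
  assumes "\<sigma> \<in> tree_aut"
  shows "\<exists>d. \<sigma> (w @ [c]) = \<sigma> w @ [d]"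
proof (induction w arbitrary: c rule: rev_induct)
  case Nil
  have "tree_adj [] [c]" by (simp add: tree_adj_def)
  then have "tree_adj (\<sigma> []) (\<sigma> [c])" "\<sigma> [] = []"
    using assms unfolding tree_aut_def by blast+
  then show ?case by (auto simp: tree_adj_def)
next
  case (snoc b w)
  obtain d where d: "\<sigma> (w @ [b]) = \<sigma> w @ [d]" using snoc by blast
  have "tree_adj (w @ [b]) (w @ [b, c])" by (simp add: tree_adj_def)
  then have "tree_adj (\<sigma> (w @ [b])) (\<sigma> (w @ [b, c]))" and inj: "inj \<sigma>"
    using assms unfolding tree_aut_def bij_def by blast+
  then consider e where "\<sigma> (w @ [b, c]) = \<sigma> (w @ [b]) @ [e]"
    | e where "\<sigma> (w @ [b]) = \<sigma> (w @ [b, c]) @ [e]"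
    unfolding tree_adj_def by blast
  then show ?case
  proof cases
    case 1
    then show ?thesis by simp
  next
    case 2
    then have "\<sigma> (w @ [b, c]) = \<sigma> w" using d by simp
    then have "w @ [b, c] = w" using injD[OF inj] by blast
    then show ?thesis by simp
  qed
qed

lemma length_tree_aut:
  assumes "\<sigma> \<in> tree_aut"
  shows "length (\<sigma> w) = length w"
proof (induction w rule: rev_induct)
  case Nil
  then show ?case using assms by (simp add: tree_aut_def)
next
  case (snoc c w)
  then show ?case using tree_aut_snoc[OF assms, of w c] by auto
qed

lemma par_eq_1_iff:
  assumes "\<sigma> \<in> tree_aut"
  shows "par \<sigma> x = 1 \<longleftrightarrow> \<sigma> (x @ [A]) = \<sigma> x @ [B]"
proof -
  obtain d where "\<sigma> (x @ [A]) = \<sigma> x @ [d]"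
    using tree_aut_snoc[OF assms] by blast
  then show ?thesis by (cases d) (simp_all add: par_def)
qed

lemma tree_aut_snoc_par:
  assumes "\<sigma> \<in> tree_aut"
  shows "\<sigma> (x @ [c]) = \<sigma> x @ [if par \<sigma> x = 1 then flip c else c]"
proof -
  obtain d e where d: "\<sigma> (x @ [A]) = \<sigma> x @ [d]" and e: "\<sigma> (x @ [B]) = \<sigma> x @ [e]"
    using tree_aut_snoc[OF assms] by meson
  have "\<sigma> (x @ [A]) \<noteq> \<sigma> (x @ [B])"
    using assms by (simp add: tree_aut_def bij_is_inj inj_eq)
  then show ?thesis
    using d e by (cases c; cases d; cases e) (auto simp: par_def)
qed

lemma tree_aut_eqI:
  assumes "\<sigma> \<in> tree_aut" "\<rho> \<in> tree_aut" "\<And>x. par \<sigma> x = par \<rho> x"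
  shows "\<sigma> = \<rho>"
proof
  fix w show "\<sigma> w = \<rho> w"
  proof (induction w rule: rev_induct)
    case Nil
    then show ?case using assms by (simp add: tree_aut_def)
  next
    case (snoc c w)
    then show ?case
      using assms by (simp add: tree_aut_snoc_par)
  qed
qed

lemma flip_flip [simp]: "flip (flip c) = c"
  by (cases c) auto

lemma portrait_aut_snoc:
  "portrait_aut p (w @ [c]) = portrait_aut p w @ [if p w then flip c else c]"
  by (induction w arbitrary: p) auto

lemma length_portrait_aut [simp]: "length (portrait_aut p w) = length w"
  by (induction w arbitrary: p) auto

lemma inj_portrait_aut: "portrait_aut p u = portrait_aut p v \<Longrightarrow> u = v"
proof (induction u arbitrary: p v)
  case Nil
  then show ?case by (cases v) auto
next
  case (Cons c u)
  then obtain d v' where v: "v = d # v'" by (cases v) auto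
  have eq: "(if p [] then flip c else c) = (if p [] then flip d else d)"
    and u: "portrait_aut (\<lambda>x. p (c # x)) u = portrait_aut (\<lambda>x. p (d # x)) v'"
    using Cons.prems v by simp_all
  have "c = d" using eq by (cases c; cases d) (simp_all split: if_splits)
  with Cons.IH u v show ?case by simp
qed

lemma surj_portrait_aut: "\<exists>u. portrait_aut p u = v"
proof (induction v arbitrary: p)
  case Nil
  show ?case by (rule exI[of _ "[]"]) simp
next
  case (Cons d v)
  define c where "c = (if p [] then flip d else d)"
  obtain u where "portrait_aut (\<lambda>x. p (c # x)) u = v" using Cons by blast
  then have "portrait_aut p (c # u) = d # v" by (simp add: c_def)
  then show ?case by blast
qed

lemma portrait_aut_in: "portrait_aut p \<in> tree_aut"
proof -
  have child: "(\<exists>c. portrait_aut p v = portrait_aut p u @ [c]) \<longleftrightarrow> (\<exists>c. v = u @ [c])" for u v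
  proof
    assume "\<exists>c. portrait_aut p v = portrait_aut p u @ [c]"
    then obtain c where c: "portrait_aut p v = portrait_aut p u @ [c]" ..
    then have "portrait_aut p (u @ [if p u then flip c else c]) = portrait_aut p v"
      by (simp add: portrait_aut_snoc)
    then show "\<exists>c. v = u @ [c]" using inj_portrait_aut by metis
  qed (auto simp: portrait_aut_snoc)
  have "bij (portrait_aut p)"
    unfolding bij_def inj_def surj_def using inj_portrait_aut surj_portrait_aut by metis
  then show ?thesis
    unfolding tree_aut_def tree_adj_def using child by simp
qed

lemma par_portrait_aut: "par (portrait_aut p) x = 1 \<longleftrightarrow> p x"
  by (simp add: par_def portrait_aut_snoc)

lemma pink_gen_in: "pink_gen r i \<in> tree_aut"
  by (simp add: pink_gen_def portrait_aut_in)

lemma par_pink_gen_1: "par (pink_gen r 1) x = 1 \<longleftrightarrow> x = []"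
  by (simp only: pink_gen_def par_portrait_aut) simp

lemma par_pink_gen:
  assumes "2 \<le> i"
  shows "par (pink_gen r i) x = 1 \<longleftrightarrow>
    (\<exists>n. x = replicate (i - 2) A @ concat (replicate n (B # replicate (r - 2) A)) @ [A])"
  using assms by (simp only: pink_gen_def par_portrait_aut) simp

lemma P_val_eq:
  assumes "\<sigma> \<in> M_group r"
  shows "Pa r \<sigma> x = P_val r \<sigma>" and "Pb r \<sigma> x = P_val r \<sigma>"
proof -
  obtain c where c: "\<forall>x. Pa r \<sigma> x = c \<and> Pb r \<sigma> x = c"
    using assms unfolding M_group_def by blast
  then have "P_val r \<sigma> = c"
    unfolding P_val_def by (intro the_equality) metis+
  with c show "Pa r \<sigma> x = P_val r \<sigma>" and "Pb r \<sigma> x = P_val r \<sigma>" by metis+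
qed

lemma R_val_eq:
  assumes "\<sigma> \<in> M_tilde r"
  shows "R_at r \<sigma> x = R_val r \<sigma>"
proof -
  obtain c where c: "\<forall>x. R_at r \<sigma> x = c"
    using assms unfolding M_tilde_def by blast
  then have "R_val r \<sigma> = c"
    unfolding R_val_def by (intro the_equality) metis+
  with c show ?thesis by metis
qed

lemma finite_words: "finite {w :: word. length w = n}"
proof -
  have "(UNIV :: letter set) = {A, B}" using letter.exhaust by blast
  then have "finite (UNIV :: letter set)" by (metis finite.emptyI finite_insert)
  from finite_lists_length_eq[OF this, of n] show ?thesis by simp
qed

lemma topspace_profinite_topology: "topspace profinite_topology = tree_aut"
  by (auto simp: profinite_topology_def topspace_pullback_topology)

end

theory Submission
  imports Defs
begin

text \<open>For an automorphism \<open>\<sigma>\<close> and a node \<open>x\<close>, the parity at \<open>x\<close>, the parity sum over the words of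
  level \<open>r - 1\<close> below \<open>x\<close>, and the parity sum over those of them below \<open>x @ [B]\<close> form an element
  \<open>phi r \<sigma> x\<close> of the dihedral group of order 8, multiplicatively in \<open>\<sigma>\<close>; membership in \<open>B_tilde r\<close>
  says that \<open>phi\<close> at the two children of every node correspond under the outer involution
  \<open>theta\<close>.  The first and last generators \<open>s\<close> and \<open>t\<close> satisfy \<open>(s t)\<^sup>4 = 1\<close>, hence
  generate a dihedral group of order 8 that \<open>phi\<close> maps isomorphically at the root; so the kernel of \<open>phi\<close>
  at the root on the abstract group \<open>\<Gamma>\<close> generated by all generators is the normal closure of the
  remaining generators, and \<open>(g, h)\<close> belongs to \<open>\<Gamma>\<close> if and only if \<open>g, h \<in> \<Gamma>\<close> and
  \<open>phi h = theta (phi g)\<close>.  Since \<open>B_tilde r\<close> satisfies the same recursion, induction on the level \<open>n\<close>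
  approximates each of its elements up to level \<open>n\<close> by an element of \<open>\<Gamma>\<close> with the same \<open>phi\<close>; while
  \<open>n < r\<close>, the value of \<open>phi\<close> is corrected by \<open>t\<close> and \<open>s t s\<close>, which fix all words shorter
  than \<open>r\<close>.\<close>

section \<open>Parities and sums over the levels of the tree\<close>

abbreviation words :: "nat \<Rightarrow> word set" where
  "words n \<equiv> {w. length w = n}"

lemma par_cong:
  assumes "\<sigma> x = \<rho> x" "\<sigma> (x @ [A]) = \<rho> (x @ [A])"
  shows "par \<sigma> x = par \<rho> x"
  using assms by (simp add: par_def)

lemma comp_in_tree_aut:
  assumes "\<sigma> \<in> tree_aut" "\<rho> \<in> tree_aut"
  shows "\<sigma> \<circ> \<rho> \<in> tree_aut"
  using assms by (simp add: tree_aut_def bij_comp)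

lemma id_in_tree_aut: "id \<in> tree_aut"
  by (simp add: tree_aut_def)

lemma par_comp:
  assumes "\<sigma> \<in> tree_aut" "\<rho> \<in> tree_aut"
  shows "par (\<sigma> \<circ> \<rho>) x = par \<sigma> (\<rho> x) + par \<rho> x"
proof -
  have "par (\<sigma> \<circ> \<rho>) x = 1 \<longleftrightarrow> par \<sigma> (\<rho> x) + par \<rho> x = 1"
    using assms
    by (cases "par \<sigma> (\<rho> x)"; cases "par \<rho> x")
      (simp_all add: par_eq_1_iff[OF comp_in_tree_aut] tree_aut_snoc_par[of \<rho>]
        tree_aut_snoc_par[of \<sigma>])
  then show ?thesis
    by (metis bit_not_one_iff)
qed

lemma par_id [simp]: "par id x = 0"
  by (simp add: par_def)

lemma tree_aut_portrait:
  assumes "\<sigma> \<in> tree_aut"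
  shows "portrait_aut (\<lambda>x. par \<sigma> x = 1) = \<sigma>"
proof (rule tree_aut_eqI[OF portrait_aut_in assms])
  show "par (portrait_aut (\<lambda>x. par \<sigma> x = 1)) x = par \<sigma> x" for x
    using par_portrait_aut[of "\<lambda>x. par \<sigma> x = 1" x] by (metis bit_not_one_iff)
qed

lemma tree_aut_fixes_short:
  assumes "\<sigma> \<in> tree_aut" "\<And>x. length x < n \<Longrightarrow> par \<sigma> x = 0" "length w \<le> n"
  shows "\<sigma> w = w"
  using assms(3)
proof (induction w rule: rev_induct)
  case Nil
  then show ?case using assms(1) by (simp add: tree_aut_def)
next
  case (snoc c w)
  then show ?case using assms(2)[of w] by (simp add: tree_aut_snoc_par[OF assms(1)])
qed

lemma sum_words_Suc:
  fixes f :: "word \<Rightarrow> 'a :: comm_monoid_add"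
  shows "(\<Sum>w\<in>words (Suc n). f w) = (\<Sum>w\<in>words n. f (A # w)) + (\<Sum>w\<in>words n. f (B # w))"
proof -
  have "words (Suc n) = Cons A ` words n \<union> Cons B ` words n"
    by (auto simp: length_Suc_conv image_iff) (metis letter.exhaust)
  then have "sum f (words (Suc n)) = sum f (Cons A ` words n) + sum f (Cons B ` words n)"
    by (simp only:) (intro sum.union_disjoint finite_imageI finite_words, auto)
  then show ?thesis
    by (simp add: sum.reindex)
qed

text \<open>\<open>\<rho>\<close> permutes each level: going down one letter at a time, it can only
  exchange the two halves of the sum.\<close>

lemma sum_words_tree_aut:
  fixes f :: "word \<Rightarrow> 'a :: comm_monoid_add"
  assumes "\<rho> \<in> tree_aut"
  shows "(\<Sum>w\<in>words n. f (\<rho> (x @ w))) = (\<Sum>w\<in>words n. f (\<rho> x @ w))"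
proof (induction n arbitrary: x)
  case 0
  then show ?case by simp
next
  case (Suc n)
  have "(\<Sum>w\<in>words n. f (\<rho> (x @ c # w)))
      = (\<Sum>w\<in>words n. f (\<rho> x @ (if par \<rho> x = 1 then flip c else c) # w))" for c
    using Suc[of "x @ [c]"] by (simp add: tree_aut_snoc_par[OF assms])
  then show ?case
    by (simp add: sum_words_Suc add.commute)
qed

section \<open>The dihedral group of order 8\<close>

type_synonym dihedral = "bit \<times> bit \<times> bit"

text \<open>\<open>(a, b, c)\<close> stands for the unitriangular matrix over the field with two elements with rows
  \<open>(1, b, c)\<close>, \<open>(0, 1, a)\<close>, \<open>(0, 0, 1)\<close>.\<close>

fun dmul :: "dihedral \<Rightarrow> dihedral \<Rightarrow> dihedral" where
  "dmul (a, b, c) (a', b', c') = (a + a', b + b', c + c' + a' * b)"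

text \<open>The term \<open>a * b\<close> is what makes the exchange of the involutions
  \<open>(1, 0, 0)\<close> and \<open>(0, 1, 0)\<close> multiplicative.\<close>

fun theta :: "dihedral \<Rightarrow> dihedral" where
  "theta (a, b, c) = (b, a, c + a * b)"

lemma dmul_zero [simp]: "dmul 0 d = d" "dmul d 0 = d"
  by (cases d, simp add: zero_prod_def)+

lemma theta_theta [simp]: "theta (theta d) = d"
proof (cases d)
  case (fields a b c)
  then show ?thesis by (cases a; cases b; cases c) simp_all
qed

lemma theta_zero [simp]: "theta 0 = 0"
  by (simp add: zero_prod_def)

lemma theta_dmul: "theta (dmul d e) = dmul (theta d) (theta e)"
proof (cases d; cases e)
  fix a b c a' b' c' assume "d = (a, b, c)" "e = (a', b', c')"
  then show ?thesis
    by (cases a; cases b; cases c; cases a'; cases b'; cases c') simp_all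
qed

lemma dmul_right_cancel: "dmul d f = dmul e f \<longleftrightarrow> d = e"
proof (cases d; cases e; cases f)
  fix a b c a' b' c' a'' b'' c''
  assume "d = (a, b, c)" "e = (a', b', c')" "f = (a'', b'', c'')"
  moreover have "x + z = y + z \<longleftrightarrow> x = y" for x y z :: bit
    by (cases x; cases y; cases z) simp_all
  ultimately show ?thesis
    by (auto simp del: add_bit_eq_xor mult_bit_eq_and)
qed

section \<open>The invariant \<open>phi\<close> and the description of
  \<open>B_tilde\<close>\<close>

definition phi :: "nat \<Rightarrow> (word \<Rightarrow> word) \<Rightarrow> word \<Rightarrow> dihedral" where
  "phi r \<sigma> x = (par \<sigma> x, \<Sum>w\<in>words (r - 1). par \<sigma> (x @ w), \<Sum>w\<in>words (r - 2). par \<sigma> (x @ B # w))"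

lemma phi_id [simp]: "phi r id x = 0"
  by (simp add: phi_def zero_prod_def)

text \<open>If \<open>\<rho>\<close> exchanges the children of \<open>x\<close>, the half sum of
  \<open>\<sigma>\<close> below the letter \<open>B\<close> turns into the one below
  \<open>A\<close>, that is, it changes by the full level sum; this is the twisting term of
  \<open>dmul\<close>.\<close>

lemma phi_comp:
  assumes "\<sigma> \<in> tree_aut" "\<rho> \<in> tree_aut" "r \<ge> 2"
  shows "phi r (\<sigma> \<circ> \<rho>) x = dmul (phi r \<sigma> (\<rho> x)) (phi r \<rho> x)"
proof -
  obtain m where r: "r = Suc (Suc m)"
    using assms(3) by (metis add_2_eq_Suc le_Suc_ex)
  define a where "a = (\<Sum>w\<in>words m. par \<sigma> (\<rho> x @ A # w))"
  define b where "b = (\<Sum>w\<in>words m. par \<sigma> (\<rho> x @ B # w))"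
  have "(\<Sum>w\<in>words (Suc m). par (\<sigma> \<circ> \<rho>) (x @ w))
      = (\<Sum>w\<in>words (Suc m). par \<sigma> (\<rho> x @ w)) + (\<Sum>w\<in>words (Suc m). par \<rho> (x @ w))"
    by (simp only: par_comp[OF assms(1,2)] sum.distrib sum_words_tree_aut[OF assms(2), of "par \<sigma>"])
  moreover have "(\<Sum>w\<in>words m. par (\<sigma> \<circ> \<rho>) (x @ B # w))
      = (if par \<rho> x = 1 then a else b) + (\<Sum>w\<in>words m. par \<rho> (x @ B # w))"
    using sum_words_tree_aut[OF assms(2), of "par \<sigma>" "x @ [B]" m]
    by (simp add: par_comp[OF assms(1,2)] sum.distrib tree_aut_snoc_par[OF assms(2)] a_def b_def
        del: add_bit_eq_xor)
  moreover have "(\<Sum>w\<in>words (Suc m). par \<sigma> (\<rho> x @ w)) = a + b"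
    by (simp only: sum_words_Suc a_def b_def)
  moreover have "(if par \<rho> x = 1 then a else b) + z = b + z + par \<rho> x * (a + b)" for z
    by (cases "par \<rho> x"; cases a; cases b; cases z) simp_all
  moreover have "r - 1 = Suc m" "r - 2 = m"
    using r by simp_all
  ultimately show ?thesis
    unfolding phi_def by (simp only: par_comp[OF assms(1,2)] dmul.simps b_def[symmetric])
qed

text \<open>The parities involved sit at words shorter than \<open>length x + r\<close>, and each
  parity looks one letter further.\<close>

lemma phi_cong:
  assumes "\<And>w. length w \<le> length x + r \<Longrightarrow> \<sigma> w = \<rho> w" "r \<ge> 2"
  shows "phi r \<sigma> x = phi r \<rho> x"
proof -
  have "par \<sigma> w = par \<rho> w" if "length w < length x + r" for w
    using that by (intro par_cong assms) simp_all
  then show ?thesis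
    using assms(2) unfolding phi_def by (auto intro!: sum.cong)
qed

text \<open>The first two coordinates express the vanishing of \<open>Pa\<close> and
  \<open>Pb\<close>. By the first one, the level sum below \<open>A\<close> that enters the third
  coordinate of \<open>theta\<close> is the parity at \<open>x @ [B]\<close>, which gives
  \<open>R_at\<close>.\<close>

lemma phi_balance_iff:
  assumes "r \<ge> 2"
  shows "phi r \<sigma> (x @ [B]) = theta (phi r \<sigma> (x @ [A]))
    \<longleftrightarrow> Pa r \<sigma> x = 0 \<and> Pb r \<sigma> x = 0 \<and> R_at r \<sigma> x = 0"
proof -
  have *: "(\<Sum>w\<in>words (r - 2). par \<sigma> (x @ A # B # w) + par \<sigma> (x @ B # B # w))
    = (\<Sum>w\<in>words (r - 2). par \<sigma> (x @ A # B # w)) + (\<Sum>w\<in>words (r - 2). par \<sigma> (x @ B # B # w))"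
    by (rule sum.distrib)
  have **: "p = q \<and> s = t \<and> u = v + t * q \<longleftrightarrow> p + q = 0 \<and> t + s = 0 \<and> t * p + (v + u) = 0"
    for p q s t u v :: bit
    by (cases p; cases q; cases s; cases t; cases u; cases v) simp_all
  show ?thesis
    unfolding phi_def Pa_def Pb_def R_at_def
    by (simp add: * del: add_bit_eq_xor mult_bit_eq_and) (rule **)
qed

lemma B_tilde_iff:
  assumes "r \<ge> 2"
  shows "\<sigma> \<in> B_tilde r \<longleftrightarrow>
    \<sigma> \<in> tree_aut \<and> (\<forall>x. phi r \<sigma> (x @ [B]) = theta (phi r \<sigma> (x @ [A])))"
proof
  assume \<sigma>: "\<sigma> \<in> B_tilde r"
  then have "\<sigma> \<in> M_tilde r" "R_val r \<sigma> = 0" "\<sigma> \<in> M_group r" "P_val r \<sigma> = 0" "\<sigma> \<in> tree_aut"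
    by (simp_all add: B_tilde_def M_tilde_def B_group_def M_group_def)
  then show "\<sigma> \<in> tree_aut \<and> (\<forall>x. phi r \<sigma> (x @ [B]) = theta (phi r \<sigma> (x @ [A])))"
    using phi_balance_iff[OF assms] P_val_eq R_val_eq by metis
next
  assume \<sigma>: "\<sigma> \<in> tree_aut \<and> (\<forall>x. phi r \<sigma> (x @ [B]) = theta (phi r \<sigma> (x @ [A])))"
  then have *: "Pa r \<sigma> x = 0" "Pb r \<sigma> x = 0" "R_at r \<sigma> x = 0" for x
    using phi_balance_iff[OF assms] by blast+
  then have M: "\<sigma> \<in> M_group r"
    using \<sigma> by (auto simp: M_group_def)
  with * have "\<sigma> \<in> B_group r"
    using P_val_eq(1)[OF M, of "[]"] by (simp add: B_group_def)
  with * have M': "\<sigma> \<in> M_tilde r"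
    by (auto simp: M_tilde_def)
  with * show "\<sigma> \<in> B_tilde r"
    using R_val_eq[OF M', of "[]"] by (simp add: B_tilde_def)
qed

lemma id_in_B_tilde:
  assumes "r \<ge> 2"
  shows "id \<in> B_tilde r"
  using assms by (simp add: B_tilde_iff id_in_tree_aut)

text \<open>As \<open>theta\<close> is an involution, the condition on the two children of a node is symmetric, so it
  survives an automorphism exchanging them.\<close>

lemma comp_in_B_tilde:
  assumes "r \<ge> 2" "\<sigma> \<in> B_tilde r" "\<rho> \<in> B_tilde r"
  shows "\<sigma> \<circ> \<rho> \<in> B_tilde r"
proof -
  have t: "\<sigma> \<in> tree_aut" "\<rho> \<in> tree_aut"
    and s: "\<And>x. phi r \<sigma> (x @ [B]) = theta (phi r \<sigma> (x @ [A]))"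
      "\<And>x. phi r \<rho> (x @ [B]) = theta (phi r \<rho> (x @ [A]))"
    using assms by (auto simp: B_tilde_iff)
  have "phi r (\<sigma> \<circ> \<rho>) (x @ [B]) = theta (phi r (\<sigma> \<circ> \<rho>) (x @ [A]))" for x
    using t assms(1) by (simp add: phi_comp theta_dmul tree_aut_snoc_par[OF t(2)] s)
  then show ?thesis
    using assms(1) t by (simp add: B_tilde_iff comp_in_tree_aut)
qed

section \<open>Automorphisms fixing the two children of the root\<close>

fun pair :: "(word \<Rightarrow> word) \<Rightarrow> (word \<Rightarrow> word) \<Rightarrow> word \<Rightarrow> word" where
  "pair g h [] = []"
| "pair g h (A # w) = A # g w"
| "pair g h (B # w) = B # h w"

lemma pair_comp: "pair g h \<circ> pair g' h' = pair (g \<circ> g') (h \<circ> h')"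
proof
  fix w show "(pair g h \<circ> pair g' h') w = pair (g \<circ> g') (h \<circ> h') w"
    by (cases "(g, h, w)" rule: pair.cases) simp_all
qed

lemma pair_id: "pair id id = id"
proof
  fix w show "pair id id w = id w"
    by (cases "(id :: word \<Rightarrow> word, id :: word \<Rightarrow> word, w)" rule: pair.cases) simp_all
qed

lemma portrait_aut_eq_pair:
  assumes "\<not> p []"
  shows "portrait_aut p = pair (portrait_aut (\<lambda>x. p (A # x))) (portrait_aut (\<lambda>x. p (B # x)))"
    (is "_ = pair ?g ?h")
proof
  fix w show "portrait_aut p w = pair ?g ?h w"
    using assms by (cases "(?g, ?h, w)" rule: pair.cases) simp_all
qed

lemma tree_aut_eq_pair:
  assumes "\<sigma> \<in> tree_aut" "par \<sigma> [] = 0"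
  obtains g h where "g \<in> tree_aut" "h \<in> tree_aut" "\<sigma> = pair g h"
proof -
  have "\<not> (par \<sigma> [] = 1)"
    using assms by simp
  from portrait_aut_eq_pair[of "\<lambda>x. par \<sigma> x = 1", OF this] show thesis
    using that portrait_aut_in tree_aut_portrait[OF assms(1)] by metis
qed

lemma par_pair [simp]:
  shows "par (pair g h) (A # w) = par g w"
    and "par (pair g h) (B # w) = par h w"
  by (simp_all add: par_def)

lemma phi_pair [simp]:
  shows "phi r (pair g h) (A # w) = phi r g w"
    and "phi r (pair g h) (B # w) = phi r h w"
  by (simp_all add: phi_def)

lemma pair_in_tree_aut:
  assumes "g \<in> tree_aut" "h \<in> tree_aut"
  shows "pair g h \<in> tree_aut"
proof -
  have "pair g h = portrait_aut (\<lambda>x. case x of [] \<Rightarrow> False | c # w \<Rightarrow>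
      (if c = A then par g w = 1 else par h w = 1))"
    by (subst portrait_aut_eq_pair) (simp_all add: tree_aut_portrait assms)
  then show ?thesis
    by (simp add: portrait_aut_in)
qed

text \<open>At the root the condition is the equation between the two values of \<open>phi\<close>;
  at any other node it is the condition for \<open>g\<close> or for \<open>h\<close>.\<close>

lemma pair_in_B_tilde_iff:
  assumes "r \<ge> 2" "g \<in> tree_aut" "h \<in> tree_aut"
  shows "pair g h \<in> B_tilde r \<longleftrightarrow>
    g \<in> B_tilde r \<and> h \<in> B_tilde r \<and> phi r h [] = theta (phi r g [])"
    (is "?l \<longleftrightarrow> ?r")
proof
  assume ?l
  then have *: "phi r (pair g h) (x @ [B]) = theta (phi r (pair g h) (x @ [A]))" for x
    using assms by (simp add: B_tilde_iff)
  show ?r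
    using *[of "[]"] *[of "A # _"] *[of "B # _"] assms by (simp add: B_tilde_iff)
next
  assume r: ?r
  have "phi r (pair g h) (x @ [B]) = theta (phi r (pair g h) (x @ [A]))" for x
    by (cases "(g, h, x)" rule: pair.cases) (use r assms in \<open>simp_all add: B_tilde_iff\<close>)
  then show ?l
    using assms by (simp add: B_tilde_iff pair_in_tree_aut)
qed

section \<open>Closure in the profinite topology\<close>

lemma in_closure_profinite_iff:
  assumes "S \<subseteq> tree_aut"
  shows "\<sigma> \<in> profinite_topology closure_of S \<longleftrightarrow>
    \<sigma> \<in> tree_aut \<and> (\<forall>n. \<exists>\<rho>\<in>S. \<forall>w. length w \<le> n \<longrightarrow> \<rho> w = \<sigma> w)"
    (is "?l \<longleftrightarrow> ?r")
proof -
  define R where "R \<sigma> n = restrict \<sigma> {w. length w \<le> n}" for \<sigma> :: "word \<Rightarrow> word" and n :: nat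
  define X where "X = product_topology (\<lambda>n::nat. discrete_topology (UNIV :: (word \<Rightarrow> word) set)) UNIV"
  have R_eq: "R \<rho> n = R \<sigma> n \<longleftrightarrow> (\<forall>w. length w \<le> n \<longrightarrow> \<rho> w = \<sigma> w)" for \<rho> \<sigma> n
    by (simp add: R_def restrict_def fun_eq_iff)
  have openin_iff: "openin profinite_topology T \<longleftrightarrow> (\<exists>U. openin X U \<and> T = R -` U \<inter> tree_aut)" for T
    by (simp add: profinite_topology_def openin_pullback_topology X_def R_def[abs_def])
  show ?thesis
  proof
    assume l: ?l
    have "\<exists>\<rho>\<in>S. \<forall>w. length w \<le> n \<longrightarrow> \<rho> w = \<sigma> w" for n
    proof -
      \<comment> \<open>Agreement with \<open>\<sigma>\<close> up to length \<open>n\<close> is an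
        open condition: it is the preimage of a point under the \<open>n\<close>-th
        projection.\<close>
      have "continuous_map X (discrete_topology UNIV) (\<lambda>f. f n)"
        unfolding X_def by (rule continuous_map_product_projection) simp
      then have "openin X {f \<in> topspace X. f n \<in> {R \<sigma> n}}"
        by (rule openin_continuous_map_preimage) simp
      then have "openin profinite_topology (R -` {f \<in> topspace X. f n \<in> {R \<sigma> n}} \<inter> tree_aut)"
        unfolding openin_iff by blast
      moreover have "topspace X = UNIV"
        by (simp add: X_def)
      moreover have "\<sigma> \<in> tree_aut"
        using l by (simp add: in_closure_of topspace_profinite_topology)
      ultimately obtain \<rho> where "\<rho> \<in> S" "R \<rho> n = R \<sigma> n"
        using l[unfolded in_closure_of, THEN conjunct2, rule_format,
            of "R -` {f \<in> topspace X. f n \<in> {R \<sigma> n}} \<inter> tree_aut"] by auto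
      then show ?thesis
        unfolding R_eq by blast
    qed
    then show ?r
      using l by (simp add: in_closure_of topspace_profinite_topology)
  next
    assume r: ?r
    have "\<exists>\<rho>. \<rho> \<in> S \<and> \<rho> \<in> T" if T: "\<sigma> \<in> T" "openin profinite_topology T" for T
    proof -
      obtain U where U: "openin X U" "T = R -` U \<inter> tree_aut"
        using T(2) unfolding openin_iff by blast
      have "R \<sigma> \<in> U"
        using T(1) unfolding U(2) by blast
      then obtain V where V: "finite {n. V n \<noteq> UNIV}" "R \<sigma> \<in> Pi\<^sub>E UNIV V" "Pi\<^sub>E UNIV V \<subseteq> U"
        using U(1)[unfolded X_def openin_product_topology_alt topspace_discrete_topology,
            THEN bspec, of "R \<sigma>"] by (simp del: PiE_UNIV_domain) (elim exE conjE)
      \<comment> \<open>A basic neighbourhood constrains finitely many levels; agreement up to their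
        largest settles all of them.\<close>
      obtain n where n: "\<And>m. V m \<noteq> UNIV \<Longrightarrow> m \<le> n"
        using V(1) unfolding finite_nat_set_iff_bounded_le by blast
      obtain \<rho> where \<rho>: "\<rho> \<in> S" "\<And>w. length w \<le> n \<Longrightarrow> \<rho> w = \<sigma> w"
        using r by blast
      have "R \<rho> m \<in> V m" for m
      proof (cases "V m = UNIV")
        case False
        then have "R \<rho> m = R \<sigma> m"
          using n[of m] \<rho>(2) by (simp add: R_eq)
        moreover have "R \<sigma> m \<in> V m"
          using V(2) by (rule PiE_mem) simp
        ultimately show ?thesis by simp
      qed simp
      then have "R \<rho> \<in> U"
        by (intro subsetD[OF V(3)] PiE_I) simp_all
      then show ?thesis
        unfolding U(2) using \<rho>(1) assms by blast
    qed
    then show ?l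
      using r by (simp add: in_closure_of topspace_profinite_topology)
  qed
qed

section \<open>The generators and their recursion\<close>

definition root_swap :: "word \<Rightarrow> word" where
  "root_swap = portrait_aut (\<lambda>x. x = [])"

lemma portrait_aut_False: "portrait_aut (\<lambda>x. False) = id"
proof
  fix w show "portrait_aut (\<lambda>x. False) w = id w"
    by (induction w) simp_all
qed

lemma root_swap_simps [simp]: "root_swap [] = []" "root_swap (c # w) = flip c # w"
  by (simp_all add: root_swap_def portrait_aut_False)

lemma root_swap_comp_self [simp]: "root_swap \<circ> root_swap = id"
proof
  fix w show "(root_swap \<circ> root_swap) w = id w"
    by (cases w) simp_all
qed

lemma root_swap_conj_pair: "root_swap \<circ> (pair g h \<circ> root_swap) = pair h g"
proof
  fix w show "(root_swap \<circ> (pair g h \<circ> root_swap)) w = pair h g w"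
    by (cases "(g, h, w)" rule: pair.cases) simp_all
qed

lemma root_swap_in_tree_aut: "root_swap \<in> tree_aut"
  by (simp add: root_swap_def portrait_aut_in)

lemma par_root_swap: "par root_swap x = (if x = [] then 1 else 0)"
  by (cases x) (simp_all add: par_def)

lemma phi_root_swap:
  assumes "r \<ge> 3"
  shows "phi r root_swap x = (if x = [] then (1, 0, 0) else 0)"
proof -
  have "w \<noteq> []" if "w \<in> words (r - 1)" for w
    using that assms by auto
  then show ?thesis
    by (auto simp: phi_def par_root_swap zero_prod_def intro!: sum.neutral)
qed

lemma pink_gen_1: "pink_gen r (Suc 0) = root_swap"
  by (simp add: pink_gen_def root_swap_def)

text \<open>The words of the portrait are sorted by their first letter: \<open>A\<close> leaves only
  the case of no block; after \<open>B\<close>, the rest of the first block is the prefix in the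
  portrait of the last generator.\<close>

lemma pink_gen_2:
  assumes "r \<ge> 3"
  shows "pink_gen r 2 = pair root_swap (pink_gen r r)"
proof -
  let ?c = "\<lambda>n. concat (replicate n (B # replicate (r - 2) A))"
  have a: "(\<exists>n. A # x = ?c n @ [A]) \<longleftrightarrow> x = []" for x
  proof
    assume "\<exists>n. A # x = ?c n @ [A]"
    then obtain n where "A # x = ?c n @ [A]" ..
    then show "x = []" by (cases n) simp_all
  next
    assume "x = []"
    then have "A # x = ?c 0 @ [A]" by simp
    then show "\<exists>n. A # x = ?c n @ [A]" ..
  qed
  have b: "(\<exists>n. B # x = ?c n @ [A]) \<longleftrightarrow> (\<exists>n. x = replicate (r - 2) A @ ?c n @ [A])" for x
  proof
    assume "\<exists>n. B # x = ?c n @ [A]"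
    then obtain n where "B # x = ?c n @ [A]" ..
    then show "\<exists>n. x = replicate (r - 2) A @ ?c n @ [A]"
      by (cases n) (simp_all, blast)
  next
    assume "\<exists>n. x = replicate (r - 2) A @ ?c n @ [A]"
    then obtain n where "x = replicate (r - 2) A @ ?c n @ [A]" ..
    then have "B # x = ?c (Suc n) @ [A]" by simp
    then show "\<exists>n. B # x = ?c n @ [A]" ..
  qed
  have "pink_gen r 2 = portrait_aut (\<lambda>x. \<exists>n. x = ?c n @ [A])"
    by (simp add: pink_gen_def)
  also have "\<dots> = pair (portrait_aut (\<lambda>x. x = []))
      (portrait_aut (\<lambda>x. \<exists>n. x = replicate (r - 2) A @ ?c n @ [A]))"
    by (subst portrait_aut_eq_pair) (simp_all add: a b)
  finally show ?thesis
    using assms by (simp add: pink_gen_def root_swap_def)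
qed

lemma pink_gen_Suc:
  assumes "i \<ge> 2"
  shows "pink_gen r (Suc i) = pair (pink_gen r i) id"
proof -
  obtain k where i: "i = Suc (Suc k)"
    using assms by (metis add_2_eq_Suc le_Suc_ex)
  have "pink_gen r (Suc i) = portrait_aut (\<lambda>x. \<exists>n. x = A # replicate k A @
      concat (replicate n (B # replicate (r - 2) A)) @ [A])"
    by (simp add: pink_gen_def i)
  also have "\<dots> = pair (portrait_aut (\<lambda>x. \<exists>n. x = replicate k A @
      concat (replicate n (B # replicate (r - 2) A)) @ [A])) id"
    by (subst portrait_aut_eq_pair) (simp_all add: portrait_aut_False)
  finally show ?thesis
    by (simp add: pink_gen_def i)
qed

text \<open>The sections of a generator are generators or the identity, so statements on all
  generators can be proved together by induction on the word.\<close>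

lemma pink_gen_cases [consumes 2, case_names 1 2 Suc]:
  assumes "r \<ge> 3" "i \<in> {1..r}"
  obtains "i = Suc 0" "pink_gen r i = root_swap"
    | "i = 2" "pink_gen r i = pair root_swap (pink_gen r r)"
    | j where "i = Suc j" "2 \<le> j" "j < r" "pink_gen r i = pair (pink_gen r j) id"
proof -
  have "i = Suc 0 \<or> i = 2 \<or> (\<exists>j. i = Suc j \<and> 2 \<le> j \<and> j < r)"
    using assms(2) by (cases i) auto
  then show thesis
    by (elim disjE exE conjE)
      (use that pink_gen_1 pink_gen_2[OF assms(1)] pink_gen_Suc in \<open>metis\<close>)+
qed

lemma pink_gen_comp_self:
  assumes "r \<ge> 3" "i \<in> {1..r}"
  shows "pink_gen r i \<circ> pink_gen r i = id"
proof
  fix w show "(pink_gen r i \<circ> pink_gen r i) w = id w"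
    using assms(2)
  proof (induction w arbitrary: i)
    case Nil
    then show ?case by (simp add: pink_gen_def)
  next
    case (Cons c w)
    have IH: "pink_gen r j (pink_gen r j w) = w" if "1 \<le> j" "j \<le> r" for j
      using Cons.IH[of j] that by simp
    have swap: "root_swap (root_swap v) = v" for v
      by (cases v) simp_all
    from assms(1) Cons.prems show ?case
      by (cases rule: pink_gen_cases; cases c) (use assms(1) in \<open>simp_all add: IH swap\<close>)
  qed
qed

text \<open>Without a block the portrait word has length \<open>i - 1\<close>; a single block
  already makes it at least \<open>r\<close> letters long.\<close>

lemma par_pink_gen_short:
  assumes "2 \<le> i" "i \<le> r" "length x < r"
  shows "par (pink_gen r i) x = (if x = replicate (i - 1) A then 1 else 0)"
proof -
  let ?c = "\<lambda>n. concat (replicate n (B # replicate (r - 2) A))"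
  have *: "replicate (i - 2) A @ [A] = replicate (i - 1) A"
  proof -
    obtain k where "i = Suc (Suc k)"
      using assms(1) by (metis add_2_eq_Suc le_Suc_ex)
    then show ?thesis by (simp add: replicate_append_same)
  qed
  have "(\<exists>n. x = replicate (i - 2) A @ ?c n @ [A]) \<longleftrightarrow> x = replicate (i - 1) A"
  proof
    assume "\<exists>n. x = replicate (i - 2) A @ ?c n @ [A]"
    then obtain n where n: "x = replicate (i - 2) A @ ?c n @ [A]" ..
    show "x = replicate (i - 1) A"
    proof (cases n)
      case 0
      then show ?thesis using n * by simp
    next
      case (Suc m)
      then have "length x \<ge> r"
        unfolding n using assms by simp
      then show ?thesis using assms(3) by simp
    qed
  next
    assume "x = replicate (i - 1) A"
    then have "x = replicate (i - 2) A @ ?c 0 @ [A]" using * by simp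
    then show "\<exists>n. x = replicate (i - 2) A @ ?c n @ [A]" ..
  qed
  then have "par (pink_gen r i) x = 1 \<longleftrightarrow> x = replicate (i - 1) A"
    using par_pink_gen[OF assms(1)] by simp
  then show ?thesis
    by (cases "par (pink_gen r i) x") simp_all
qed

text \<open>Up to level \<open>r - 1\<close> the only active node is
  \<open>replicate (i - 1) A\<close>: it is not the root, lies on level \<open>r - 1\<close> only
  for \<open>i = r\<close>, and is never below \<open>B\<close>.\<close>

lemma phi_pink_gen:
  assumes "2 \<le> i" "i \<le> r"
  shows "phi r (pink_gen r i) [] = (if i = r then (0, 1, 0) else 0)"
proof -
  have 1: "par (pink_gen r i) [] = 0"
    using par_pink_gen_short[OF assms, of "[]"] assms by auto
  have "(\<Sum>w\<in>words (r - 1). par (pink_gen r i) w)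
      = (\<Sum>w\<in>words (r - 1). if w = replicate (i - 1) A then 1 else 0)"
    using assms by (intro sum.cong) (auto simp: par_pink_gen_short)
  then have 2: "(\<Sum>w\<in>words (r - 1). par (pink_gen r i) w) = (if i = r then 1 else 0)"
    using assms by (auto simp: sum.delta finite_words)
  have "B # w \<noteq> replicate (i - 1) A" for w
    by (cases "i - 1") auto
  then have 3: "(\<Sum>w\<in>words (r - 2). par (pink_gen r i) (B # w)) = 0"
    using assms by (intro sum.neutral) (auto simp: par_pink_gen_short)
  show ?thesis
    using 1 2 3 by (simp add: phi_def zero_prod_def)
qed

text \<open>At the root the only nontrivial case is the second generator, whose sections have the
  values \<open>(1, 0, 0)\<close> and \<open>(0, 1, 0)\<close>, exchanged by \<open>theta\<close>;
  deeper nodes inherit the condition from the sections.\<close>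

lemma pink_gen_in_B_tilde:
  assumes "r \<ge> 3" "i \<in> {1..r}"
  shows "pink_gen r i \<in> B_tilde r"
proof -
  have "phi r (pink_gen r i) (x @ [B]) = theta (phi r (pink_gen r i) (x @ [A]))" for x
    using assms(2)
  proof (induction x arbitrary: i)
    case Nil
    with assms(1) show ?case
      by (cases rule: pink_gen_cases)
        (use assms(1) in \<open>simp_all add: phi_root_swap phi_pink_gen zero_prod_def\<close>)
  next
    case (Cons c x)
    from assms(1) Cons.prems show ?case
      by (cases rule: pink_gen_cases; cases c)
        (use assms(1) in \<open>simp_all add: phi_root_swap Cons.IH\<close>)
  qed
  then show ?thesis
    using assms(1) by (simp add: B_tilde_iff pink_gen_in)
qed

lemma phi_comp_root:
  assumes "\<sigma> \<in> tree_aut" "\<rho> \<in> tree_aut" "r \<ge> 3"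
  shows "phi r (\<sigma> \<circ> \<rho>) [] = dmul (phi r \<sigma> []) (phi r \<rho> [])"
proof -
  have "\<rho> [] = []"
    using assms(2) by (simp add: tree_aut_def)
  then show ?thesis
    using assms by (simp add: phi_comp)
qed

section \<open>The abstract group \<Gamma>, before taking the closure\<close>

definition pink_group :: "nat \<Rightarrow> (word \<Rightarrow> word) set" where
  "pink_group r = generate tree_aut_group (pink_gen r ` {1..r})"

context
  fixes r :: nat
  assumes r: "r \<ge> 3"
begin

lemma id_in_pink_group: "id \<in> pink_group r"
  using generate.one[of tree_aut_group] by (simp add: pink_group_def tree_aut_group_def)

lemma pink_gen_in_pink_group: "i \<in> {1..r} \<Longrightarrow> pink_gen r i \<in> pink_group r"
  by (simp add: pink_group_def generate.incl)

lemma root_swap_in_pink_group: "root_swap \<in> pink_group r"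
  using pink_gen_in_pink_group[of 1] r by (simp add: pink_gen_1)

lemma comp_in_pink_group:
  "\<sigma> \<in> pink_group r \<Longrightarrow> \<rho> \<in> pink_group r \<Longrightarrow> \<sigma> \<circ> \<rho> \<in> pink_group r"
  using generate.eng[of \<sigma> tree_aut_group _ \<rho>] by (simp add: pink_group_def tree_aut_group_def)

text \<open>The generators are involutions, so every element is a product of generators and no case
  for inverses arises.\<close>

lemma pink_group_induct [consumes 1, case_names id gen comp]:
  assumes "\<sigma> \<in> pink_group r"
    and "P id"
    and gen: "\<And>i. i \<in> {1..r} \<Longrightarrow> P (pink_gen r i)"
    and comp: "\<And>\<sigma> \<rho>. \<sigma> \<in> pink_group r \<Longrightarrow> \<rho> \<in> pink_group r \<Longrightarrow> P \<sigma> \<Longrightarrow> P \<rho> \<Longrightarrow> P (\<sigma> \<circ> \<rho>)"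
  shows "P \<sigma>"
  using assms(1) unfolding pink_group_def
proof (induction rule: generate.induct)
  case one
  have "\<one>\<^bsub>tree_aut_group\<^esub> = id"
    by (simp add: tree_aut_group_def)
  then show ?case using assms(2) by (simp only:)
next
  case (incl h)
  then show ?case using gen by blast
next
  case (inv h)
  then obtain i where i: "i \<in> {1..r}" "h = pink_gen r i" by blast
  then have "inv\<^bsub>tree_aut_group\<^esub> h = h"
    using pink_gen_comp_self[OF r i(1)] pink_gen_in
    by (intro group.inv_equality[OF group_tree_aut_group]) (simp_all add: tree_aut_group_def)
  then show ?case using gen i by simp
next
  case (eng h1 h2)
  then have "h1 \<in> pink_group r" "h2 \<in> pink_group r" "P h1" "P h2"
    by (simp_all only: pink_group_def)
  moreover have "h1 \<otimes>\<^bsub>tree_aut_group\<^esub> h2 = h1 \<circ> h2"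
    by (simp add: tree_aut_group_def)
  ultimately show ?case using comp by (simp only:)
qed

lemma pink_group_subset_B_tilde: "\<sigma> \<in> pink_group r \<Longrightarrow> \<sigma> \<in> B_tilde r"
proof (induction rule: pink_group_induct)
  case id
  show ?case using r by (intro id_in_B_tilde) simp
next
  case (gen i)
  then show ?case by (rule pink_gen_in_B_tilde[OF r])
next
  case (comp \<sigma> \<rho>)
  then show ?case using r by (intro comp_in_B_tilde) simp_all
qed

lemma pink_group_tree_aut: "\<sigma> \<in> pink_group r \<Longrightarrow> \<sigma> \<in> tree_aut"
  using pink_group_subset_B_tilde r by (simp add: B_tilde_iff)

lemma pink_group_inverse:
  assumes "\<sigma> \<in> pink_group r"
  shows "\<exists>\<rho>\<in>pink_group r. \<rho> \<circ> \<sigma> = id"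
  using assms
proof (induction rule: pink_group_induct)
  case id
  then show ?case using id_in_pink_group by (intro bexI[of _ id]) simp_all
next
  case (gen i)
  then show ?case using pink_gen_comp_self[OF r gen] pink_gen_in_pink_group by blast
next
  case (comp \<sigma> \<rho>)
  then obtain \<sigma>' \<rho>' where *: "\<sigma>' \<in> pink_group r" "\<rho>' \<in> pink_group r"
    "\<sigma>' \<circ> \<sigma> = id" "\<rho>' \<circ> \<rho> = id" by blast
  then have "(\<rho>' \<circ> \<sigma>') \<circ> (\<sigma> \<circ> \<rho>) = id"
    by (metis comp_assoc comp_id)
  then show ?case using * comp_in_pink_group by blast
qed

section \<open>Pairs inside \<Gamma> and the kernel of \<open>phi\<close>\<close>

lemma pair_commute_in_pink_group:
  "pair g h \<in> pink_group r \<Longrightarrow> pair h g \<in> pink_group r"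
  using comp_in_pink_group root_swap_in_pink_group root_swap_conj_pair by metis

lemma pair_pink_gen_id:
  assumes "2 \<le> i" "i < r"
  shows "pair (pink_gen r i) id \<in> pink_group r"
  using pink_gen_in_pink_group[of "Suc i"] assms by (simp add: pink_gen_Suc)

lemma pair_root_swap_pink_gen: "pair root_swap (pink_gen r r) \<in> pink_group r"
  using pink_gen_in_pink_group[of 2] r by (simp add: pink_gen_2)

text \<open>Each generator is the first section of some generator or of its conjugate by
  \<open>root_swap\<close>; products follow coordinatewise.\<close>

lemma ex_pair_in_pink_group:
  assumes "g \<in> pink_group r"
  shows "\<exists>h\<in>pink_group r. pair g h \<in> pink_group r"
  using assms
proof (induction rule: pink_group_induct)
  case id
  then show ?case using id_in_pink_group pair_id by metis
next
  case (gen i)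
  then consider "i = Suc 0" | "i = r" | "2 \<le> i" "i < r" by force
  then show ?case
  proof cases
    case 1
    then show ?thesis
      using pair_root_swap_pink_gen pink_gen_in_pink_group[of r] r by (auto simp: pink_gen_1)
  next
    case 2
    then show ?thesis
      using pair_commute_in_pink_group[OF pair_root_swap_pink_gen] root_swap_in_pink_group by blast
  next
    case 3
    then show ?thesis using pair_pink_gen_id id_in_pink_group by blast
  qed
next
  case (comp \<sigma> \<rho>)
  then show ?case using comp_in_pink_group pair_comp by metis
qed

text \<open>With \<open>t\<close> the last generator, conjugation by \<open>pair root_swap t\<close>
  or \<open>pair t root_swap\<close> conjugates \<open>n\<close> and cancels in the second
  coordinate, as both sections are involutions.\<close>

lemma pair_conj_in_pink_group:
  assumes "pair n id \<in> pink_group r" "s = root_swap \<or> s = pink_gen r r"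
  shows "pair (s \<circ> n \<circ> s) id \<in> pink_group r"
proof -
  let ?t = "pink_gen r r"
  have t: "?t \<circ> ?t = id"
    using pink_gen_comp_self[OF r, of r] r by simp
  have "pair root_swap ?t \<circ> pair n id \<circ> pair root_swap ?t = pair (root_swap \<circ> n \<circ> root_swap) id"
    "pair ?t root_swap \<circ> pair n id \<circ> pair ?t root_swap = pair (?t \<circ> n \<circ> ?t) id"
    by (simp_all add: pair_comp t)
  then show ?thesis
    using assms pair_root_swap_pink_gen pair_commute_in_pink_group comp_in_pink_group by metis
qed

text \<open>The alternating words in \<open>s\<close> and \<open>t\<close> of length at most 4; the
  two of length 4 coincide because the fourth power of \<open>s \<circ> t\<close> is
  trivial.\<close>

definition dihedral_elems :: "(word \<Rightarrow> word) set" where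
  "dihedral_elems = (let s = root_swap; t = pink_gen r r in
     {id, s, t, s \<circ> t, t \<circ> s, s \<circ> (t \<circ> s), t \<circ> (s \<circ> t), s \<circ> (t \<circ> (s \<circ> t))})"

lemma pink_gen_r_comp_self: "pink_gen r r \<circ> pink_gen r r = id"
  using pink_gen_comp_self[OF r, of r] r by simp

text \<open>The last generator moves only words below the letter \<open>A\<close>, its conjugate by the swap only words
  below \<open>B\<close>, so these two involutions commute.\<close>

lemma root_swap_pink_gen_commute:
  "pink_gen r r \<circ> (root_swap \<circ> (pink_gen r r \<circ> root_swap))
    = root_swap \<circ> (pink_gen r r \<circ> (root_swap \<circ> pink_gen r r))"
proof -
  obtain j where j: "r = Suc j" "j \<ge> 2"
    using r by (cases r) auto
  have t: "pink_gen r r = pair (pink_gen r j) id"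
    using j pink_gen_Suc by metis
  have "pink_gen r r \<circ> (root_swap \<circ> (pink_gen r r \<circ> root_swap))
      = (root_swap \<circ> (pink_gen r r \<circ> root_swap)) \<circ> pink_gen r r"
    by (simp add: t root_swap_conj_pair pair_comp)
  then show ?thesis
    by (simp add: comp_assoc)
qed

lemma dihedral_elems_closed:
  assumes "d \<in> dihedral_elems"
  shows "root_swap \<circ> d \<in> dihedral_elems" "pink_gen r r \<circ> d \<in> dihedral_elems"
proof -
  let ?s = root_swap and ?t = "pink_gen r r"
  have [simp]: "?s \<circ> (?s \<circ> x) = x" "?t \<circ> (?t \<circ> x) = x" "?t \<circ> ?t = id"
    "?t \<circ> (?s \<circ> (?t \<circ> ?s)) = ?s \<circ> (?t \<circ> (?s \<circ> ?t))" for x :: "word \<Rightarrow> word"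
    using root_swap_comp_self pink_gen_r_comp_self root_swap_pink_gen_commute
    by (metis comp_assoc id_comp)+
  have [simp]: "?t \<circ> (?s \<circ> (?t \<circ> (?s \<circ> ?t))) = ?s \<circ> (?t \<circ> ?s)"
    using root_swap_pink_gen_commute by (metis \<open>\<And>x. ?t \<circ> (?t \<circ> x) = x\<close>)
  show "?s \<circ> d \<in> dihedral_elems" "?t \<circ> d \<in> dihedral_elems"
    using assms by (auto simp: dihedral_elems_def Let_def)
qed

text \<open>By multiplicativity, the values \<open>(1, 0, 0)\<close> and \<open>(0, 1, 0)\<close> of
  the two involutions give each of the seven other words a nonzero value.\<close>

lemma dihedral_elems_phi:
  assumes "d \<in> dihedral_elems" "phi r d [] = 0"
  shows "d = id"
  using assms r
  by (auto simp: dihedral_elems_def Let_def phi_comp_root comp_in_tree_aut root_swap_in_tree_aut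
      pink_gen_in phi_root_swap phi_pink_gen zero_prod_def)

text \<open>The elements \<open>n\<close> with \<open>pair n id\<close> in \<Gamma> include the
  middle generators and are stable under conjugation by the first and the last one, so these two can
  be collected on the right.\<close>

lemma pink_group_decomp:
  assumes "g \<in> pink_group r"
  shows "\<exists>n d. n \<in> pink_group r \<and> pair n id \<in> pink_group r \<and> d \<in> dihedral_elems \<and> g = n \<circ> d"
proof -
  define Q where "Q g \<longleftrightarrow>
    (\<exists>n d. n \<in> pink_group r \<and> pair n id \<in> pink_group r \<and> d \<in> dihedral_elems \<and> g = n \<circ> d)" for g
  \<comment> \<open>With an arbitrary right factor \<open>x\<close>, the case of a composition is
    immediate.\<close>
  have "\<forall>x. Q x \<longrightarrow> Q (g \<circ> x)"
    using assms
  proof (induction rule: pink_group_induct)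
    case id
    then show ?case by simp
  next
    case (gen i)
    show ?case
    proof (intro allI impI)
      fix x assume "Q x"
      then obtain n d where nd: "n \<in> pink_group r" "pair n id \<in> pink_group r"
        "d \<in> dihedral_elems" "x = n \<circ> d"
        unfolding Q_def by blast
      let ?s = "pink_gen r i"
      have s: "?s \<in> pink_group r" "?s \<circ> ?s = id"
        using gen pink_gen_in_pink_group pink_gen_comp_self[OF r] by blast+
      show "Q (?s \<circ> x)"
      proof (cases "2 \<le> i \<and> i < r")
        case True
        have "?s \<circ> n \<in> pink_group r" "pair (?s \<circ> n) id \<in> pink_group r"
          using comp_in_pink_group[OF s(1) nd(1)] pair_pink_gen_id[of i] True nd(2)
            comp_in_pink_group[of "pair ?s id" "pair n id"] by (simp_all add: pair_comp)
        then show ?thesis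
          using nd(3,4) unfolding Q_def by (metis comp_assoc)
      next
        case False
        then have i: "?s = root_swap \<or> ?s = pink_gen r r"
          using gen pink_gen_1 by (metis One_nat_def Suc_1 atLeastAtMost_iff le_antisym not_less not_less_eq_eq)
        then have "?s \<circ> d \<in> dihedral_elems"
          using dihedral_elems_closed[OF nd(3)] by metis
        moreover have "pair (?s \<circ> n \<circ> ?s) id \<in> pink_group r"
          using pair_conj_in_pink_group[OF nd(2) i] .
        moreover have "?s \<circ> n \<circ> ?s \<in> pink_group r"
          using s(1) nd(1) by (intro comp_in_pink_group)
        \<comment> \<open>The involution is inserted twice: one copy completes the conjugate of
          \<open>n\<close>, the other joins \<open>d\<close>.\<close>
        moreover have "?s \<circ> x = (?s \<circ> n \<circ> ?s) \<circ> (?s \<circ> d)"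
          using s(2) nd(4) by (metis comp_assoc comp_id)
        ultimately show ?thesis
          unfolding Q_def by blast
      qed
    qed
  next
    case (comp \<sigma> \<rho>)
    then show ?case by (metis comp_assoc)
  qed
  moreover have "Q id"
  proof -
    have "id \<in> dihedral_elems" by (simp add: dihedral_elems_def Let_def)
    then show ?thesis
      unfolding Q_def using id_in_pink_group pair_id by (metis comp_id)
  qed
  ultimately have "Q (g \<circ> id)" by blast
  then show ?thesis unfolding Q_def by simp
qed

lemma pair_id_in_pink_group:
  assumes "g \<in> pink_group r" "phi r g [] = 0"
  shows "pair g id \<in> pink_group r"
proof -
  obtain n d where nd: "n \<in> pink_group r" "pair n id \<in> pink_group r" "d \<in> dihedral_elems" "g = n \<circ> d"
    using pink_group_decomp[OF assms(1)] by blast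
  have "d \<in> tree_aut"
    using nd(3) by (auto simp: dihedral_elems_def Let_def comp_in_tree_aut root_swap_in_tree_aut
        pink_gen_in id_in_tree_aut)
  \<comment> \<open>As \<open>pair n id\<close> lies in \<open>B_tilde r\<close>, the value of
    \<open>n\<close> corresponds to that of \<open>id\<close> and vanishes; hence \<open>d\<close>
    carries the whole value of \<open>g\<close>.\<close>
  have "phi r id [] = theta (phi r n [])"
    using pink_group_subset_B_tilde[OF nd(2)] pink_group_tree_aut[OF nd(1)] id_in_tree_aut r
    by (simp add: pair_in_B_tilde_iff)
  then have "phi r n [] = 0"
    by (metis phi_id theta_theta theta_zero)
  then have "phi r d [] = 0"
    using assms(2) nd(1,4) \<open>d \<in> tree_aut\<close> r by (simp add: phi_comp_root pink_group_tree_aut)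
  then show ?thesis
    using dihedral_elems_phi[OF nd(3)] nd(2,4) by simp
qed

lemma pair_in_pink_group:
  assumes "g \<in> pink_group r" "h \<in> pink_group r" "phi r h [] = theta (phi r g [])"
  shows "pair g h \<in> pink_group r"
proof -
  obtain h' where h': "h' \<in> pink_group r" "pair g h' \<in> pink_group r"
    using ex_pair_in_pink_group[OF assms(1)] by blast
  obtain k where k: "k \<in> pink_group r" "k \<circ> h' = id"
    using pink_group_inverse[OF h'(1)] by blast
  \<comment> \<open>The partner \<open>h'\<close> of \<open>g\<close> has the same
    \<open>phi\<close> as \<open>h\<close>, so the quotient \<open>h''\<close> lies in the kernel
    and corrects the second section.\<close>
  define h'' where "h'' = h \<circ> k"
  have h'': "h'' \<in> pink_group r" "h'' \<circ> h' = h"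
    using k assms(2) by (simp_all add: h''_def comp_in_pink_group comp_assoc)
  have "phi r h' [] = theta (phi r g [])"
    using pink_group_subset_B_tilde[OF h'(2)] assms(1) h'(1) r
    by (simp add: pair_in_B_tilde_iff pink_group_tree_aut)
  moreover have "phi r h [] = dmul (phi r h'' []) (phi r h' [])"
    using phi_comp_root[OF pink_group_tree_aut[OF h''(1)] pink_group_tree_aut[OF h'(1)] r] h''(2)
    by simp
  ultimately have "dmul (phi r h'' []) (phi r h' []) = dmul 0 (phi r h' [])"
    using assms(3) by simp
  then have "pair id h'' \<in> pink_group r"
    using h''(1) by (simp only: dmul_right_cancel pair_id_in_pink_group pair_commute_in_pink_group)
  then show ?thesis
    using comp_in_pink_group[OF _ h'(2)] h''(2) by (metis pair_comp id_comp)
qed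

section \<open>Approximation of the elements of \<open>B_tilde\<close>\<close>

lemma pink_group_adjust_phi:
  assumes "\<gamma> \<in> pink_group r" "par \<gamma> [] = par \<sigma> []"
  shows "\<exists>\<gamma>'\<in>pink_group r. phi r \<gamma>' [] = phi r \<sigma> [] \<and> (\<forall>w. length w < r \<longrightarrow> \<gamma>' w = \<gamma> w)"
proof -
  let ?t = "pink_gen r r"
  let ?u = "root_swap \<circ> (?t \<circ> root_swap)"
  have t: "?t \<in> pink_group r"
    using pink_gen_in_pink_group[of r] r by simp
  then have u: "?u \<in> pink_group r"
    by (intro comp_in_pink_group root_swap_in_pink_group)
  \<comment> \<open>The shortest active node of the last generator has length \<open>r - 1\<close>,
    so words up to that length are fixed.\<close>
  have "par ?t x = 0" if "length x < r - 1" for x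
    using that r by (subst par_pink_gen_short) auto
  then have t_short: "?t w = w" if "length w < r" for w
    using that r by (intro tree_aut_fixes_short[OF pink_gen_in, where n = "r - 1"]) auto
  have u_short: "?u w = w" if "length w < r" for w
  proof -
    have "length (root_swap w) < r"
      using that by (simp add: length_tree_aut[OF root_swap_in_tree_aut])
    moreover have "root_swap (root_swap w) = w"
      by (cases w) simp_all
    ultimately show ?thesis
      by (simp add: t_short)
  qed
  have ex_\<delta>: "\<exists>\<delta>\<in>pink_group r. phi r \<delta> [] = (0, b, c) \<and> (\<forall>w. length w < r \<longrightarrow> \<delta> w = w)" for b c
  proof -
    have pt: "phi r ?t [] = (0, 1, 0)"
      using r by (simp add: phi_pink_gen)
    have pu: "phi r ?u [] = (0, 1, 1)"
      using r by (simp add: pt phi_comp_root phi_root_swap comp_in_tree_aut root_swap_in_tree_aut pink_gen_in)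
    have ptu: "phi r (?t \<circ> ?u) [] = (0, 0, 1)"
      unfolding phi_comp_root[OF pink_group_tree_aut[OF t] pink_group_tree_aut[OF u] r] pt pu by simp
    have p1: "phi r id [] = (0, 0, 0)"
      by (simp add: zero_prod_def)
    \<comment> \<open>The values \<open>(0, 1, 0)\<close> of \<open>?t\<close> and
      \<open>(0, 1, 1)\<close> of \<open>?u\<close> generate all values with first coordinate
      0.\<close>
    define \<delta> where "\<delta> = (if b = 0 then (if c = 0 then id else ?t \<circ> ?u) else if c = 0 then ?t else ?u)"
    have "\<delta> \<in> pink_group r"
      using t u id_in_pink_group comp_in_pink_group[OF t u] by (simp only: \<delta>_def split: if_split) blast
    moreover have "phi r \<delta> [] = (0, b, c)"
      unfolding \<delta>_def using pt pu ptu p1 by (cases b; cases c) (simp_all only: if_True if_False simp_thms zero_neq_one one_neq_zero)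
    moreover have "\<delta> w = w" if "length w < r" for w
      using t_short[OF that] u_short[OF that] by (simp add: \<delta>_def)
    ultimately show ?thesis by blast
  qed
  obtain a b c where \<gamma>: "phi r \<gamma> [] = (a, b, c)"
    by (rule prod_cases3)
  obtain b' c' where \<sigma>: "phi r \<sigma> [] = (a, b', c')"
    using \<gamma> assms(2) by (simp add: phi_def)
  \<comment> \<open>A right factor with first coordinate 0 produces no twisting term, so these
    differences lead from the value of \<open>\<gamma>\<close> to that of
    \<open>\<sigma>\<close>.\<close>
  obtain \<delta> where \<delta>: "\<delta> \<in> pink_group r" "phi r \<delta> [] = (0, b + b', c + c')"
    "\<And>w. length w < r \<Longrightarrow> \<delta> w = w"
    using ex_\<delta>[of "b + b'" "c + c'"] by blast
  have "x + (x + y) = y" for x y :: bit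
    by (cases x; cases y) simp_all
  then have "phi r (\<gamma> \<circ> \<delta>) [] = phi r \<sigma> []"
    using r \<gamma> \<sigma> \<delta>(1,2) assms(1)
    by (simp add: phi_comp_root pink_group_tree_aut del: add_bit_eq_xor mult_bit_eq_and)
  then show ?thesis
    using comp_in_pink_group[OF assms(1) \<delta>(1)] \<delta>(3) by (intro bexI[of _ "\<gamma> \<circ> \<delta>"]) simp_all
qed

text \<open>Equality of \<open>phi\<close> is carried along because approximations of the two
  sections can be paired only if their values correspond under \<open>theta\<close>.\<close>

lemma pink_group_dense_in_B_tilde:
  assumes "\<sigma> \<in> B_tilde r"
  shows "\<exists>\<gamma>\<in>pink_group r. phi r \<gamma> [] = phi r \<sigma> [] \<and> (\<forall>w. length w \<le> n \<longrightarrow> \<gamma> w = \<sigma> w)"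
  using assms
proof (induction n arbitrary: \<sigma>)
  case 0
  obtain \<gamma> where \<gamma>: "\<gamma> \<in> pink_group r" "par \<gamma> [] = par \<sigma> []"
    using id_in_pink_group root_swap_in_pink_group par_root_swap[of "[]"] par_id[of "[]"]
    by (metis bit_not_one_iff)
  then obtain \<gamma>' where "\<gamma>' \<in> pink_group r" "phi r \<gamma>' [] = phi r \<sigma> []"
    using pink_group_adjust_phi by blast
  then show ?case
    using pink_group_tree_aut 0 r by (auto simp: B_tilde_iff tree_aut_def)
next
  case (Suc n)
  have even: "\<exists>\<gamma>\<in>pink_group r. \<forall>w. length w \<le> Suc n \<longrightarrow> \<gamma> w = \<sigma> w"
    if \<sigma>: "\<sigma> \<in> B_tilde r" "par \<sigma> [] = 0" for \<sigma>
  proof -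
    have "\<sigma> \<in> tree_aut"
      using \<sigma>(1) r by (simp add: B_tilde_iff)
    then obtain g h where gh: "g \<in> tree_aut" "h \<in> tree_aut" "\<sigma> = pair g h"
      using tree_aut_eq_pair \<sigma>(2) by blast
    then have B: "g \<in> B_tilde r" "h \<in> B_tilde r" "phi r h [] = theta (phi r g [])"
      using \<sigma>(1) r by (simp_all add: pair_in_B_tilde_iff)
    obtain g' h' where g': "g' \<in> pink_group r" "phi r g' [] = phi r g []"
        "\<And>w. length w \<le> n \<Longrightarrow> g' w = g w"
      and h': "h' \<in> pink_group r" "phi r h' [] = phi r h []"
        "\<And>w. length w \<le> n \<Longrightarrow> h' w = h w"
      using Suc.IH[OF B(1)] Suc.IH[OF B(2)] by blast
    have "pair g' h' \<in> pink_group r"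
      using g' h' B(3) by (intro pair_in_pink_group) simp_all
    moreover have "pair g' h' w = \<sigma> w" if "length w \<le> Suc n" for w
      using that g'(3) h'(3) by (cases "(g, h, w)" rule: pair.cases) (simp_all add: gh(3))
    ultimately show ?thesis by blast
  qed
  have t: "\<sigma> \<in> tree_aut"
    using Suc.prems r by (simp add: B_tilde_iff)
  have "\<exists>\<gamma>\<in>pink_group r. \<forall>w. length w \<le> Suc n \<longrightarrow> \<gamma> w = \<sigma> w"
  proof (cases "par \<sigma> [] = 0")
    case True
    then show ?thesis using even Suc.prems by blast
  next
    case False
    \<comment> \<open>The swap reduces an odd root parity to the even case and is undone
      afterwards.\<close>
    have "root_swap \<circ> \<sigma> \<in> B_tilde r"
      using Suc.prems pink_group_subset_B_tilde[OF root_swap_in_pink_group] r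
      by (simp add: comp_in_B_tilde)
    moreover have "par (root_swap \<circ> \<sigma>) [] = 0"
    proof -
      have "\<sigma> [] = []"
        using t by (simp add: tree_aut_def)
      then show ?thesis
        using False t by (simp add: par_comp root_swap_in_tree_aut par_root_swap)
    qed
    ultimately obtain \<gamma> where \<gamma>: "\<gamma> \<in> pink_group r"
      "\<And>w. length w \<le> Suc n \<Longrightarrow> \<gamma> w = root_swap (\<sigma> w)"
      using even by (metis comp_apply)
    have "root_swap (root_swap w) = w" for w
      by (cases w) simp_all
    then show ?thesis
      using \<gamma> comp_in_pink_group[OF root_swap_in_pink_group \<gamma>(1)]
      by (intro bexI[of _ "root_swap \<circ> \<gamma>"]) simp_all
  qed
  then obtain \<gamma> where \<gamma>: "\<gamma> \<in> pink_group r" "\<And>w. length w \<le> Suc n \<Longrightarrow> \<gamma> w = \<sigma> w"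
    by blast
  show ?case
  \<comment> \<open>Below level \<open>r\<close> the agreement need not determine \<open>phi\<close>
    at the root, which is corrected; from level \<open>r\<close> on, \<open>phi\<close> reads only
    words already matched.\<close>
  proof (cases "Suc n < r")
    case True
    have "par \<gamma> [] = par \<sigma> []"
      using \<gamma>(2) by (intro par_cong) simp_all
    from pink_group_adjust_phi[OF \<gamma>(1) this] obtain \<gamma>' where
      "\<gamma>' \<in> pink_group r" "phi r \<gamma>' [] = phi r \<sigma> []" "\<And>w. length w < r \<Longrightarrow> \<gamma>' w = \<gamma> w"
      by blast
    then show ?thesis
      using \<gamma>(2) True by (intro bexI[of _ \<gamma>']) simp_all
  next
    case False
    then have "phi r \<gamma> [] = phi r \<sigma> []"
      using \<gamma>(2) r by (intro phi_cong) simp_all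
    then show ?thesis using \<gamma> by blast
  qed
qed

end

theorem theorem6p7:
  fixes r :: nat
  assumes "r \<ge> 3"
  shows "G_Pink r = B_tilde r"
proof -
  have r2: "r \<ge> 2"
    using assms by simp
  have sub: "pink_group r \<subseteq> tree_aut"
    using pink_group_tree_aut[OF assms] by blast
  show ?thesis
  proof (intro subset_antisym subsetI)
    fix \<sigma> assume "\<sigma> \<in> G_Pink r"
    then have \<sigma>: "\<sigma> \<in> tree_aut" "\<And>n. \<exists>\<rho>\<in>pink_group r. \<forall>w. length w \<le> n \<longrightarrow> \<rho> w = \<sigma> w"
      unfolding G_Pink_def pink_group_def[symmetric] in_closure_profinite_iff[OF sub] by blast+
    have "phi r \<sigma> (x @ [B]) = theta (phi r \<sigma> (x @ [A]))" for x
    proof -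
      \<comment> \<open>The children of \<open>x\<close> have length \<open>length x + 1\<close>,
        and \<open>phi\<close> there looks \<open>r\<close> levels further.\<close>
      obtain \<rho> where \<rho>: "\<rho> \<in> pink_group r" "\<And>w. length w \<le> length x + 1 + r \<Longrightarrow> \<rho> w = \<sigma> w"
        using \<sigma>(2) by blast
      have "phi r \<rho> (x @ [c]) = phi r \<sigma> (x @ [c])" for c
        using \<rho>(2) r2 by (intro phi_cong) simp_all
      moreover have "phi r \<rho> (x @ [B]) = theta (phi r \<rho> (x @ [A]))"
        using pink_group_subset_B_tilde[OF assms \<rho>(1)] by (simp add: B_tilde_iff[OF r2])
      ultimately show ?thesis by simp
    qed
    then show "\<sigma> \<in> B_tilde r"
      using \<sigma>(1) by (simp add: B_tilde_iff[OF r2])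
  next
    fix \<sigma> assume \<sigma>: "\<sigma> \<in> B_tilde r"
    then have "\<sigma> \<in> tree_aut"
      by (simp add: B_tilde_iff[OF r2])
    then show "\<sigma> \<in> G_Pink r"
      unfolding G_Pink_def pink_group_def[symmetric] in_closure_profinite_iff[OF sub]
      using pink_group_dense_in_B_tilde[OF assms \<sigma>] by blast
  qed
qed

end
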